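(* Let $a>0$, $\sigma_0,\sigma_1,\sigma_2\in\mathbb{C}\setminus\{0,-1\}$, $g=e^{-2a}/(2a)$, and $$\mathbb{P}=\frac12\begin{pmatrix}1&1/a\\ a&1\end{pmatrix},\quad R=\frac12\begin{pmatrix}1&1/a\\ -a&-1\end{pmatrix},\quad X=\begin{pmatrix}1&0\\0&-1\end{pmatrix}.$$ Let $J_3=D^{-1}N\in\mathbb{C}^{8\times8}$, where $$D=\operatorname{diag}\big((1+\sigma_1)\mathrm{I}-\mathbb{P},\ (1+\sigma_0)\mathrm{I}-\mathbb{P},\ (1+\sigma_0)\mathrm{I}-\mathbb{P},\ (1+\sigma_2)\mathrm{I}-\mathbb{P}\big)$$ is block diagonal and $$N=\begin{pmatrix}0&\sigma_1X&0&0\\ \sigma_0X&0&2agR&0\\ 0&2agR&0&\sigma_0X\\ 0&0&\sigma_2X&0\end{pmatrix}.$$ Then the spectrum of $J_3$ is $$\sigma(J_3)=\left\{-\sqrt{\frac{\sigma_j}{\sigma_j+1}},\ \sqrt{\frac{\sigma_j}{\sigma_j+1}}\ :\ j=0,1,2\right\}.$$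
   Context: $\mathrm{I}$ is the $2\times2$ identity matrix, and $\pm\sqrt z$ denotes the two complex square roots of $z\in\mathbb{C}$. $J_3$ is the block Jacobi iteration matrix of the multitrace formulation for $-u''+a^2u=0$ with the three subdomains $(-\infty,-1)$, $(-1,1)$, $(1,\infty)$; $g=\mathcal{G}(2)=\mathcal{G}(-2)$ with the Green's function $\mathcal{G}(x)=e^{-a|x|}/(2a)$. *)

theory Defs
  imports
    Complex_Main
    "Jordan_Normal_Form.Gauss_Jordan_Elimination"
    "Jordan_Normal_Form.Spectral_Radius"
begin

definition P_mat :: "real \<Rightarrow> complex mat" where
  "P_mat a = (1/2) \<cdot>\<^sub>m mat_of_rows_list 2
     [[1, 1 / of_real a],
      [of_real a, 1]]"

definition R_mat :: "real \<Rightarrow> complex mat" where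
  "R_mat a = (1/2) \<cdot>\<^sub>m mat_of_rows_list 2
     [[1, 1 / of_real a],
      [- of_real a, - 1]]"

definition X_mat :: "complex mat" where
  "X_mat = mat_of_rows_list 2
     [[1, 0],
      [0, - 1]]"

(* The matrix assembled from a rectangular array of k x k blocks, given by rows. *)
definition mat_of_blocks :: "nat \<Rightarrow> 'a mat list list \<Rightarrow> 'a mat" where
  "mat_of_blocks k Bs = mat (k * length Bs) (k * length (hd Bs))
     (\<lambda>(i, j). (Bs ! (i div k) ! (j div k)) $$ (i mod k, j mod k))"

definition D_mat :: "real \<Rightarrow> (nat \<Rightarrow> complex) \<Rightarrow> complex mat" where
  "D_mat a \<sigma> = diag_block_mat
     [(1 + \<sigma> 1) \<cdot>\<^sub>m 1\<^sub>m 2 - P_mat a,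
      (1 + \<sigma> 0) \<cdot>\<^sub>m 1\<^sub>m 2 - P_mat a,
      (1 + \<sigma> 0) \<cdot>\<^sub>m 1\<^sub>m 2 - P_mat a,
      (1 + \<sigma> 2) \<cdot>\<^sub>m 1\<^sub>m 2 - P_mat a]"

definition N_mat :: "real \<Rightarrow> real \<Rightarrow> (nat \<Rightarrow> complex) \<Rightarrow> complex mat" where
  "N_mat a g \<sigma> =
     (let O2 = 0\<^sub>m 2 2; C = of_real (2 * a * g) \<cdot>\<^sub>m R_mat a in
      mat_of_blocks 2
        [[O2,                   \<sigma> 1 \<cdot>\<^sub>m X_mat, O2,                   O2],
         [\<sigma> 0 \<cdot>\<^sub>m X_mat, O2,                   C,                    O2],
         [O2,                   C,                    O2,                   \<sigma> 0 \<cdot>\<^sub>m X_mat],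
         [O2,                   O2,                   \<sigma> 2 \<cdot>\<^sub>m X_mat, O2]])"

(* mat_inverse returns Some exactly on invertible matrices; D_mat a \<sigma> is invertible when
   a > 0 and \<sigma> 0, \<sigma> 1, \<sigma> 2 avoid 0 and -1: P_mat a is a projector of rank 1, so
   the block (1 + s) I - P_mat a has eigenvalues s and 1 + s. *)
definition J3_mat :: "real \<Rightarrow> real \<Rightarrow> (nat \<Rightarrow> complex) \<Rightarrow> complex mat" where
  "J3_mat a g \<sigma> = the (mat_inverse (D_mat a \<sigma>)) * N_mat a g \<sigma>"

end

(* P is the projector with range (1, a) and kernel (1, -a), X swaps these two vectors, and R maps
   (1, a) to (1, -a) and (1, -a) to 0.  In this basis D is diagonal, and half of the equations
   in N v = x D v express the (1, -a)-coordinates of v through its (1, a)-coordinates p.  With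
   t j = \<sigma> j - x^2 (1 + \<sigma> j) the other half reads t 1 p1 = 0, t 2 p2 = 0, t 0 p0 + c p2 = 0,
   t 0 p3 + c p1 = 0, a triangular system that is singular iff t 0 t 1 t 2 = 0. *)
theory Submission
  imports Defs
begin

section \<open>Coordinates with respect to (1, a) and (1, -a)\<close>

text \<open>Block \<open>k\<close> of \<open>wave a p q\<close> is \<open>p k (1, a) + q k (1, -a)\<close>.\<close>

definition wave :: "real \<Rightarrow> (nat \<Rightarrow> complex) \<Rightarrow> (nat \<Rightarrow> complex) \<Rightarrow> complex vec" where
  "wave a p q = vec 8 (\<lambda>i. if even i then p (i div 2) + q (i div 2)
     else of_real a * (p (i div 2) - q (i div 2)))"

lemma wave_carrier [simp]: "wave a p q \<in> carrier_vec 8" "dim_vec (wave a p q) = 8"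
  by (simp_all add: wave_def)

lemma wave_surj:
  assumes "a \<noteq> 0" "v \<in> carrier_vec 8"
  obtains p q where "v = wave a p q"
proof
  \<comment> \<open>These values solve v(2k) = p k + q k and v(2k+1) = a (p k - q k), whence the
    division by \<open>a\<close>.\<close>
  show "v = wave a (\<lambda>k. (v $ (2 * k) + v $ (2 * k + 1) / of_real a) / 2)
      (\<lambda>k. (v $ (2 * k) - v $ (2 * k + 1) / of_real a) / 2)"
    using assms by (intro eq_vecI) (auto simp: wave_def field_simps elim!: oddE)
qed

text \<open>For nonzero \<open>a\<close> the vectors (1, a) and (1, -a) are linearly independent;
  only the values at k < 4 enter the vector.\<close>

lemma wave_eq_iff:
  assumes "a \<noteq> 0"
  shows "wave a p q = wave a p' q' \<longleftrightarrow> (\<forall>k<4. p k = p' k \<and> q k = q' k)"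
proof
  assume eq: "wave a p q = wave a p' q'"
  show "\<forall>k<4. p k = p' k \<and> q k = q' k"
  proof (intro allI impI)
    fix k :: nat assume k: "k < 4"
    have "wave a p q $ (2 * k) = wave a p' q' $ (2 * k)"
      "wave a p q $ (2 * k + 1) = wave a p' q' $ (2 * k + 1)"
      using eq by simp_all
    then have s: "p k + q k = p' k + q' k" and d: "p k - q k = p' k - q' k"
      using k assms by (simp_all add: wave_def)
    have "2 * p k = 2 * p' k" "2 * q k = 2 * q' k"
      using arg_cong2[OF s d, of "(+)"] arg_cong2[OF s d, of "(-)"] by simp_all
    then show "p k = p' k \<and> q k = q' k" by simp
  qed
qed (auto simp: wave_def)

lemma wave_0: "wave a (\<lambda>k. 0) (\<lambda>k. 0) = 0\<^sub>v 8"
  by (auto simp: wave_def)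

lemma smult_wave: "c \<cdot>\<^sub>v wave a p q = wave a (\<lambda>k. c * p k) (\<lambda>k. c * q k)"
  by (auto simp: wave_def algebra_simps)

section \<open>Action of \<open>D_mat\<close> and \<open>N_mat\<close> in these coordinates\<close>

lemma sum_less_8: "(\<Sum>i = 0..<8. f i) = f 0 + f 1 + f 2 + f 3 + f 4 + f 5 + f 6 + (f (7::nat) :: complex)"
  by (simp add: eval_nat_numeral)

lemma D_mat_carrier: "D_mat a \<sigma> \<in> carrier_mat 8 8"
  by (auto simp: D_mat_def P_mat_def mat_of_rows_list_def Let_def)

lemma N_mat_carrier: "N_mat a g \<sigma> \<in> carrier_mat 8 8"
  by (auto simp: N_mat_def mat_of_blocks_def Let_def)

text \<open>The blocks are the two sides of one interface, then those of the other. The middle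
  subdomain, with parameter \<open>\<sigma> 0\<close>, borders both and so occurs twice.\<close>

definition param :: "(nat \<Rightarrow> complex) \<Rightarrow> nat \<Rightarrow> complex" where
  "param \<sigma> k = \<sigma> ([1, 0, 0, 2] ! k)"

text \<open>Splitting off the first block shifts both indices by \<open>k\<close>, which lowers the
  quotients by one and keeps the remainders.\<close>

lemma diag_block_mat_index:
  assumes "\<And>A. A \<in> set As \<Longrightarrow> A \<in> carrier_mat k k"
    and "i < k * length As" "j < k * length As"
  shows "diag_block_mat As $$ (i, j) =
    (if i div k = j div k then (As ! (i div k)) $$ (i mod k, j mod k) else 0)"
  using assms
proof (induction As arbitrary: i j)
  case (Cons A As)
  have A: "A \<in> carrier_mat k k"
    using Cons.prems(1) by simp
  have As: "B \<in> carrier_mat k k" if "B \<in> set As" for B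
    using Cons.prems(1) that by simp
  have dims: "dim_row (diag_block_mat As) = k * length As" "dim_col (diag_block_mat As) = k * length As"
    using As by (induction As) (auto simp: Let_def)
  have k: "k > 0"
    using Cons.prems(2) by (cases k) auto
  have low: "n div k = 0 \<and> n mod k = n" if "n < k" for n
    using that by simp
  have high: "n div k = Suc ((n - k) div k) \<and> n mod k = (n - k) mod k" if "\<not> n < k" for n
    using that k by (simp add: le_div_geq le_mod_geq)
  have ij: "i < k + k * length As" "j < k + k * length As"
    using Cons.prems(2,3) by simp_all
  have "diag_block_mat (A # As) $$ (i, j) =
    (if i < k then if j < k then A $$ (i, j) else 0
     else if j < k then 0 else diag_block_mat As $$ (i - k, j - k))"
    using A ij by (auto simp: Let_def dims)
  then show ?case
    using Cons.IH[OF As, of "i - k" "j - k"] ij low high by auto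
qed simp

lemma D_mat_index:
  assumes "i < 8" "j < 8"
  shows "D_mat a \<sigma> $$ (i, j) = (if i div 2 = j div 2
    then ((1 + param \<sigma> (i div 2)) \<cdot>\<^sub>m 1\<^sub>m 2 - P_mat a) $$ (i mod 2, j mod 2) else 0)"
proof -
  let ?As = "map (\<lambda>k. (1 + param \<sigma> k) \<cdot>\<^sub>m 1\<^sub>m 2 - P_mat a) [0..<4]"
  have "D_mat a \<sigma> = diag_block_mat ?As"
    by (simp add: D_mat_def param_def upt_rec)
  moreover have "A \<in> carrier_mat 2 2" if "A \<in> set ?As" for A
    using that by (auto simp: P_mat_def mat_of_rows_list_def)
  ultimately show ?thesis
    using assms diag_block_mat_index[of ?As 2 i j] by (auto simp del: upt_conv_Cons)
qed

text \<open>\<open>P_mat a\<close> fixes (1, a) and annihilates (1, -a), so (1 + s) I - P scales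
  them by s and 1 + s.\<close>

lemma D_mat_wave:
  assumes "a \<noteq> 0"
  shows "D_mat a \<sigma> *\<^sub>v wave a p q =
    wave a (\<lambda>k. param \<sigma> k * p k) (\<lambda>k. (1 + param \<sigma> k) * q k)" (is "_ = ?w")
proof (rule eq_vecI)
  fix i
  assume "i < dim_vec ?w"
  then have i: "i < 8" by simp
  have "(D_mat a \<sigma> *\<^sub>v wave a p q) $ i = (\<Sum>j = 0..<8. D_mat a \<sigma> $$ (i, j) * wave a p q $ j)"
    using i D_mat_carrier[of a \<sigma>] by (simp add: scalar_prod_def)
  also have "\<dots> = (\<Sum>j = 0..<8. (if i div 2 = j div 2
    then ((1 + param \<sigma> (i div 2)) \<cdot>\<^sub>m 1\<^sub>m 2 - P_mat a) $$ (i mod 2, j mod 2) else 0) * wave a p q $ j)"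
    using i by (intro sum.cong) (simp_all add: D_mat_index)
  also have "\<dots> = ?w $ i"
  proof -
    have "i = 0 \<or> i = 1 \<or> i = 2 \<or> i = 3 \<or> i = 4 \<or> i = 5 \<or> i = 6 \<or> i = 7"
      using i by auto
    then show ?thesis
      unfolding sum_less_8 P_mat_def mat_of_rows_list_def wave_def
      using assms by (elim disjE) (simp_all add: field_simps)
  qed
  finally show "(D_mat a \<sigma> *\<^sub>v wave a p q) $ i = ?w $ i" .
qed (use D_mat_carrier[of a \<sigma>] in simp)

text \<open>The list [1, 0, 3, 2] pairs each block with the other side of its interface, where
  \<open>X_mat\<close> exchanges the two coordinates. The coupling through \<open>R_mat a\<close>
  only takes \<open>p\<close> of one inner block into \<open>q\<close> of the other.\<close>

lemma N_mat_wave: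
  assumes "a \<noteq> 0"
  shows "N_mat a g \<sigma> *\<^sub>v wave a p q =
    wave a (\<lambda>k. param \<sigma> k * q ([1, 0, 3, 2] ! k))
      (\<lambda>k. param \<sigma> k * p ([1, 0, 3, 2] ! k) +
         of_real (2 * a * g) * [0, p 2, p 1, 0] ! k)" (is "_ = ?w")
proof (rule eq_vecI)
  fix i
  assume "i < dim_vec ?w"
  then have i: "i < 8" by simp
  have "(N_mat a g \<sigma> *\<^sub>v wave a p q) $ i = (\<Sum>j = 0..<8. N_mat a g \<sigma> $$ (i, j) * wave a p q $ j)"
    using i N_mat_carrier[of a g \<sigma>] by (simp add: scalar_prod_def)
  also have "\<dots> = ?w $ i"
  proof -
    have "i = 0 \<or> i = 1 \<or> i = 2 \<or> i = 3 \<or> i = 4 \<or> i = 5 \<or> i = 6 \<or> i = 7"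
      using i by auto
    then show ?thesis
      unfolding sum_less_8 N_mat_def mat_of_blocks_def R_mat_def X_mat_def mat_of_rows_list_def
        wave_def param_def Let_def
      using assms by (elim disjE) (simp_all, simp_all add: algebra_simps)
  qed
  finally show "(N_mat a g \<sigma> *\<^sub>v wave a p q) $ i = ?w $ i" .
qed (use N_mat_carrier[of a g \<sigma>] in simp)

section \<open>Generalized eigenvalue problem and the spectrum\<close>

text \<open>Multiplying the eigenvector equation by \<open>A\<close> or \<open>B\<close> passes
  between the two forms, so the entries of the inverse need not be computed.\<close>

lemma eigenvalue_left_inverse_mult_iff:
  fixes A B N :: "'a :: field mat"
  assumes A: "A \<in> carrier_mat n n" and B: "B \<in> carrier_mat n n" and N: "N \<in> carrier_mat n n"
    and AB: "A * B = 1\<^sub>m n" and BA: "B * A = 1\<^sub>m n"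
  shows "eigenvalue (B * N) x \<longleftrightarrow>
    (\<exists>v \<in> carrier_vec n. v \<noteq> 0\<^sub>v n \<and> N *\<^sub>v v = x \<cdot>\<^sub>v (A *\<^sub>v v))"
proof -
  have "(B * N) *\<^sub>v v = x \<cdot>\<^sub>v v \<longleftrightarrow> N *\<^sub>v v = x \<cdot>\<^sub>v (A *\<^sub>v v)" if v: "v \<in> carrier_vec n" for v
  proof
    assume "(B * N) *\<^sub>v v = x \<cdot>\<^sub>v v"
    then have "A *\<^sub>v (B *\<^sub>v (N *\<^sub>v v)) = A *\<^sub>v (x \<cdot>\<^sub>v v)"
      using assoc_mult_mat_vec[OF B N v] by simp
    moreover have "A *\<^sub>v (B *\<^sub>v (N *\<^sub>v v)) = N *\<^sub>v v"
      using assoc_mult_mat_vec[OF A B, of "N *\<^sub>v v"] AB N v by simp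
    ultimately show "N *\<^sub>v v = x \<cdot>\<^sub>v (A *\<^sub>v v)"
      using mult_mat_vec[OF A v] by simp
  next
    assume "N *\<^sub>v v = x \<cdot>\<^sub>v (A *\<^sub>v v)"
    then have "(B * N) *\<^sub>v v = x \<cdot>\<^sub>v (B *\<^sub>v (A *\<^sub>v v))"
      using assoc_mult_mat_vec[OF B N v] mult_mat_vec[OF B, of "A *\<^sub>v v"] A v by simp
    also have "B *\<^sub>v (A *\<^sub>v v) = v"
      using assoc_mult_mat_vec[OF B A v] BA v by simp
    finally show "(B * N) *\<^sub>v v = x \<cdot>\<^sub>v v" .
  qed
  moreover have "dim_row (B * N) = n"
    using B by simp
  ultimately show ?thesis
    unfolding eigenvalue_def eigenvector_def by auto
qed

text \<open>This resolves the \<open>the\<close> in \<open>J3_mat\<close>. In wave coordinates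
  \<open>D_mat a \<sigma>\<close> is diagonal with nonzero entries \<open>param \<sigma> k\<close>
  and \<open>1 + param \<sigma> k\<close>, so its kernel is trivial.\<close>

lemma D_mat_inverse:
  assumes "a \<noteq> 0" and \<sigma>: "\<forall>j\<in>{0, 1, 2}. \<sigma> j \<notin> {0, - 1}"
  obtains B where "mat_inverse (D_mat a \<sigma>) = Some B" "B \<in> carrier_mat 8 8"
    "D_mat a \<sigma> * B = 1\<^sub>m 8" "B * D_mat a \<sigma> = 1\<^sub>m 8"
proof -
  have nz: "param \<sigma> k \<noteq> 0 \<and> 1 + param \<sigma> k \<noteq> 0" if "k < 4" for k
  proof -
    have "[1, 0, 0, 2] ! k \<in> {0, 1, 2 :: nat}"
      using that nth_mem[of k "[1, 0, 0, 2 :: nat]"] by auto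
    then have "param \<sigma> k \<notin> {0, - 1}"
      using \<sigma> unfolding param_def by blast
    then show ?thesis
      by (simp add: add_eq_0_iff)
  qed
  have "v = 0\<^sub>v 8" if v: "v \<in> carrier_vec 8" and Dv: "D_mat a \<sigma> *\<^sub>v v = 0\<^sub>v 8" for v
  proof -
    obtain p q where v_eq: "v = wave a p q"
      using wave_surj[OF assms(1) v] .
    then have "wave a (\<lambda>k. param \<sigma> k * p k) (\<lambda>k. (1 + param \<sigma> k) * q k) = wave a (\<lambda>k. 0) (\<lambda>k. 0)"
      using Dv by (simp only: D_mat_wave[OF assms(1)] wave_0)
    then have "\<forall>k<4. p k = 0 \<and> q k = 0"
      using nz unfolding wave_eq_iff[OF assms(1)] by auto
    then have "wave a p q = wave a (\<lambda>k. 0) (\<lambda>k. 0)"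
      unfolding wave_eq_iff[OF assms(1)] .
    then show ?thesis
      by (simp only: v_eq wave_0)
  qed
  then have "det (D_mat a \<sigma>) \<noteq> 0"
    using det_0_iff_vec_prod_zero[OF D_mat_carrier] by blast
  \<comment> \<open>The argument \<open>b\<close> is a dummy of the matrix ring; fixing it to
    \<open>()\<close> in both facts makes them speak of the same units.\<close>
  then have "mat_inverse (D_mat a \<sigma>) \<noteq> None"
    using mat_inverse(1)[OF D_mat_carrier, where b = "()"]
      det_non_zero_imp_unit[OF D_mat_carrier, where b = "()"] by metis
  then obtain B where "mat_inverse (D_mat a \<sigma>) = Some B"
    by blast
  with that mat_inverse(2)[OF D_mat_carrier this] show thesis
    by simp
qed

text \<open>Working with \<open>x\<^sup>2\<close> treats both square roots at once.\<close>

lemma eigenvalue_J3_mat_iff: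
  assumes "a \<noteq> 0" and \<sigma>: "\<forall>j\<in>{0, 1, 2}. \<sigma> j \<notin> {0, - 1}"
  shows "eigenvalue (J3_mat a g \<sigma>) x \<longleftrightarrow> (\<exists>j\<in>{0, 1, 2}. x\<^sup>2 = \<sigma> j / (\<sigma> j + 1))"
proof -
  define c :: complex where "c = of_real (2 * a * g)"
  define t where "t j = \<sigma> j - x\<^sup>2 * (1 + \<sigma> j)" for j
  have nz: "\<sigma> 0 \<noteq> 0" "\<sigma> 1 \<noteq> 0" "\<sigma> 2 \<noteq> 0"
    using \<sigma> by auto
  obtain B where B: "mat_inverse (D_mat a \<sigma>) = Some B" "B \<in> carrier_mat 8 8"
    "D_mat a \<sigma> * B = 1\<^sub>m 8" "B * D_mat a \<sigma> = 1\<^sub>m 8"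
    using D_mat_inverse[OF assms] .
  have all4: "(\<forall>k<4. Q k) \<longleftrightarrow> Q 0 \<and> Q 1 \<and> Q 2 \<and> Q (3::nat)" for Q
    by (auto simp: eval_nat_numeral less_Suc_eq)
  have wave_iff: "N_mat a g \<sigma> *\<^sub>v wave a p q = x \<cdot>\<^sub>v (D_mat a \<sigma> *\<^sub>v wave a p q) \<longleftrightarrow>
      q 0 = x * p 1 \<and> q 1 = x * p 0 \<and> q 2 = x * p 3 \<and> q 3 = x * p 2 \<and>
      t 1 * p 1 = 0 \<and> t 0 * p 0 + c * p 2 = 0 \<and> t 0 * p 3 + c * p 1 = 0 \<and> t 2 * p 2 = 0"
    (is "?eq \<longleftrightarrow> ?sys") for p q
  proof -
    \<comment> \<open>Along (1, a) both sides share the factor \<open>param \<sigma> k\<close>;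
      cancelling it by \<open>nz\<close> gives the equations for \<open>q\<close>. Substituting
      these into the rest then produces the factors \<open>t j\<close>.\<close>
    have "?eq \<longleftrightarrow> q 0 = x * p 1 \<and> q 1 = x * p 0 \<and> q 2 = x * p 3 \<and> q 3 = x * p 2 \<and>
      \<sigma> 1 * p 1 = x * ((1 + \<sigma> 1) * q 0) \<and> \<sigma> 0 * p 0 + c * p 2 = x * ((1 + \<sigma> 0) * q 1) \<and>
      \<sigma> 0 * p 3 + c * p 1 = x * ((1 + \<sigma> 0) * q 2) \<and> \<sigma> 2 * p 2 = x * ((1 + \<sigma> 2) * q 3)"
      using nz unfolding D_mat_wave[OF assms(1)] N_mat_wave[OF assms(1)] smult_wave
        wave_eq_iff[OF assms(1)] all4 c_def[symmetric]
      by (auto simp: param_def)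
    also have "\<dots> \<longleftrightarrow> ?sys"
      by (auto simp: t_def algebra_simps power2_eq_square)
    finally show ?thesis .
  qed
  have "eigenvalue (J3_mat a g \<sigma>) x \<longleftrightarrow>
      (\<exists>v \<in> carrier_vec 8. v \<noteq> 0\<^sub>v 8 \<and> N_mat a g \<sigma> *\<^sub>v v = x \<cdot>\<^sub>v (D_mat a \<sigma> *\<^sub>v v))"
    using eigenvalue_left_inverse_mult_iff[OF D_mat_carrier B(2) N_mat_carrier B(3,4)]
    by (simp add: J3_mat_def B(1))
  also have "\<dots> \<longleftrightarrow> (\<exists>p q. wave a p q \<noteq> 0\<^sub>v 8 \<and>
      N_mat a g \<sigma> *\<^sub>v wave a p q = x \<cdot>\<^sub>v (D_mat a \<sigma> *\<^sub>v wave a p q))"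
    by (metis wave_surj[OF assms(1)] wave_carrier(1))
  \<comment> \<open>If the values of \<open>p\<close> vanish, so do those of \<open>q\<close>; a
    solution is therefore nonzero iff its \<open>p\<close> part is, and \<open>q\<close> can be
    eliminated.\<close>
  also have "\<dots> \<longleftrightarrow> (\<exists>p0 p1 p2 p3. (p0, p1, p2, p3) \<noteq> (0, 0, 0, 0) \<and>
      t 1 * p1 = 0 \<and> t 0 * p0 + c * p2 = 0 \<and> t 0 * p3 + c * p1 = 0 \<and> t 2 * p2 = 0)"
    (is "?L \<longleftrightarrow> ?R")
  proof
    assume ?L
    then obtain p q where "wave a p q \<noteq> 0\<^sub>v 8"
      and "N_mat a g \<sigma> *\<^sub>v wave a p q = x \<cdot>\<^sub>v (D_mat a \<sigma> *\<^sub>v wave a p q)"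
      by blast
    then have "(p 0, p 1, p 2, p 3) \<noteq> (0, 0, 0, 0) \<and>
      t 1 * p 1 = 0 \<and> t 0 * p 0 + c * p 2 = 0 \<and> t 0 * p 3 + c * p 1 = 0 \<and> t 2 * p 2 = 0"
      unfolding wave_iff wave_0[of a, symmetric] wave_eq_iff[OF assms(1)] all4 by auto
    then show ?R by blast
  next
    assume ?R
    then obtain p0 p1 p2 p3 where "(p0, p1, p2, p3) \<noteq> (0, 0, 0, 0)"
      "t 1 * p1 = 0" "t 0 * p0 + c * p2 = 0" "t 0 * p3 + c * p1 = 0" "t 2 * p2 = 0"
      by blast
    then have "wave a p q \<noteq> 0\<^sub>v 8 \<and>
        N_mat a g \<sigma> *\<^sub>v wave a p q = x \<cdot>\<^sub>v (D_mat a \<sigma> *\<^sub>v wave a p q)"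
      if "p = (\<lambda>k. [p0, p1, p2, p3] ! k)" "q = (\<lambda>k. [x * p1, x * p0, x * p3, x * p2] ! k)" for p q
      unfolding wave_iff wave_0[of a, symmetric] wave_eq_iff[OF assms(1)] all4 that by auto
    then show ?L by blast
  qed
  also have "\<dots> \<longleftrightarrow> t 0 = 0 \<or> t 1 = 0 \<or> t 2 = 0" (is "?L \<longleftrightarrow> ?R")
  proof
    assume ?R
    \<comment> \<open>Treating \<open>t 0 = 0\<close> first lets the other cases divide by
      \<open>t 0\<close>: there \<open>p1\<close> or \<open>p2\<close> is set to 1, and its coupling
      equation determines \<open>p3\<close> or \<open>p0\<close>.\<close>
    consider "t 0 = 0" | "t 0 \<noteq> 0" "t 1 = 0" | "t 0 \<noteq> 0" "t 2 = 0"
      using \<open>?R\<close> by blast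
    then show ?L
    proof cases
      case 1
      then have "((1, 0, 0, 0) :: complex \<times> complex \<times> complex \<times> complex) \<noteq> (0, 0, 0, 0) \<and>
        t 1 * 0 = 0 \<and> t 0 * 1 + c * 0 = 0 \<and> t 0 * 0 + c * 0 = 0 \<and> t 2 * 0 = 0"
        by simp
      then show ?thesis by blast
    next
      case 2
      then have "(0 :: complex, 1 :: complex, 0 :: complex, - c / t 0) \<noteq> (0, 0, 0, 0) \<and>
        t 1 * 1 = 0 \<and> t 0 * 0 + c * 0 = 0 \<and> t 0 * (- c / t 0) + c * 1 = 0 \<and> t 2 * 0 = 0"
        by simp
      then show ?thesis by blast
    next
      case 3
      then have "(- c / t 0, 0 :: complex, 1 :: complex, 0 :: complex) \<noteq> (0, 0, 0, 0) \<and>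
        t 1 * 0 = 0 \<and> t 0 * (- c / t 0) + c * 1 = 0 \<and> t 0 * 0 + c * 0 = 0 \<and> t 2 * 1 = 0"
        by simp
      then show ?thesis by blast
    qed
  \<comment> \<open>Conversely, if no \<open>t j\<close> vanishes, then p1 = p2 = 0, and the coupled
    equations force p0 = p3 = 0.\<close>
  qed auto
  also have "\<dots> \<longleftrightarrow> (\<exists>j\<in>{0, 1, 2}. x\<^sup>2 = \<sigma> j / (\<sigma> j + 1))"
  proof -
    have "t j = 0 \<longleftrightarrow> x\<^sup>2 = \<sigma> j / (\<sigma> j + 1)" if "j \<in> {0, 1, 2}" for j
    proof -
      have "\<sigma> j + 1 \<noteq> 0"
        using \<sigma> that by (auto simp: add_eq_0_iff2)
      then show ?thesis
        by (auto simp: t_def eq_divide_eq add.commute)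
    qed
    then show ?thesis by simp
  qed
  finally show ?thesis .
qed

theorem mainTheorem3:
  fixes a g :: real and \<sigma> :: "nat \<Rightarrow> complex"
  assumes "a > 0"
    and "\<forall>j\<in>{0, 1, 2}. \<sigma> j \<notin> {0, - 1}"
    and "g = exp (- 2 * a) / (2 * a)"
  shows "spectrum (J3_mat a g \<sigma>) =
    (\<Union>j\<in>{0, 1, 2}. {- csqrt (\<sigma> j / (\<sigma> j + 1)), csqrt (\<sigma> j / (\<sigma> j + 1))})"
proof -
  have "x\<^sup>2 = z \<longleftrightarrow> x \<in> {- csqrt z, csqrt z}" for x z
    using power2_eq_iff[of x "csqrt z"] by auto
  moreover have "a \<noteq> 0"
    using assms(1) by simp
  ultimately show ?thesis
    unfolding spectrum_def using eigenvalue_J3_mat_iff[OF _ assms(2), of a g] by auto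
qed

end
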